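(* Let $(X,\{\star_1,\dots,\star_k\})$ be a multispindle and let $C(X)$ be its multi-term chain complex for integer scalars $a_1,\dots,a_k$. Then the short exact sequence of chain complexes $$0\to C^D(X)\xrightarrow{\ i\ } C(X)\xrightarrow{\ \beta\ } C^N(X)\to 0$$ ($i$ the inclusion of the degenerate subcomplex, $\beta$ the quotient map) splits, with a splitting chain map $\alpha\colon C^N(X)\to C(X)$ given by the formula $$\alpha(x_0,x_1,x_2,\dots,x_n)=(x_0,\,x_1-x_0,\,x_2-x_1,\dots,\,x_n-x_{n-1}).$$ In particular $H_n(X)\cong H_n^D(X)\oplus H_n^N(X)$ for all $n$.
   Context: A multispindle $(X,\{\star_1,\dots,\star_k\})$ is a set $X$ with binary operations such that $(x\star_\alpha y)\star_\beta z=(x\star_\beta z)\star_\alpha(y\star_\beta z)$ for all $x,y,z\in X$ and all $\alpha,\beta$ (including $\alpha=\beta$), and $x\star_\alpha x=x$ for all $x,\alpha$. The multi-term chain complex $C(X)$ for integer scalars $a_1,\dots,a_k$ has $C_n(X)=\mathbb Z X^{n+1}$ for $n\ge0$ (zero for $n<0$) and $\partial=\sum_r a_r\partial^{\star_r}$, where $\partial^\star_n=\sum_{i=0}^n(-1)^i d_i^\star$ for $n\ge1$, $\partial_0=0$, $d_0^\star(x_0,\dots,x_n)=(x_1,\dots,x_n)$, and $d_i^\star(x_0,\dots,x_n)=(x_0\star x_i,\dots,x_{i-1}\star x_i,x_{i+1},\dots,x_n)$ for $i\geq1$. Degeneracies: $s_j(x_0,\dots,x_n)=(x_0,\dots,x_{j-1},x_j,x_j,x_{j+1},\dots,x_n)$,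 $0\le j\le n$. The degenerate subcomplex is $C^D_n(X)=\mathrm{span}\{s_0(C_{n-1}(X)),\dots,s_{n-1}(C_{n-1}(X))\}$, and $C^N(X)=C(X)/C^D(X)$. $H(X)$, $H^D(X)$, $H^N(X)$ are the homologies of $C(X)$, $C^D(X)$, $C^N(X)$. In the formula for $\alpha$ the tuple is expanded multilinearly, e.g. $(x_0,x_1-x_0,x_2-x_1)=(x_0,x_1,x_2)-(x_0,x_0,x_2)-(x_0,x_1,x_1)+(x_0,x_0,x_1)$. *)

theory Defs
  imports "HOL-Algebra.Free_Abelian_Groups"
begin

text \<open>Chain complexes are indexed by the integers, so that the groups in negative
  degrees are really present.\<close>

record 'c chain_data =
  grp :: "int \<Rightarrow> 'c monoid"
  bdry :: "int \<Rightarrow> 'c \<Rightarrow> 'c"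

definition chain_complex :: "'c chain_data \<Rightarrow> bool" where
  "chain_complex A \<longleftrightarrow>
     (\<forall>n. comm_group (grp A n)) \<and>
     (\<forall>n. bdry A n \<in> hom (grp A n) (grp A (n - 1))) \<and>
     (\<forall>n. \<forall>c \<in> carrier (grp A n). bdry A (n - 1) (bdry A n c) = \<one>\<^bsub>grp A (n - 2)\<^esub>)"

definition chain_map :: "'c chain_data \<Rightarrow> 'd chain_data \<Rightarrow> (int \<Rightarrow> 'c \<Rightarrow> 'd) \<Rightarrow> bool" where
  "chain_map A B f \<longleftrightarrow>
     (\<forall>n. f n \<in> hom (grp A n) (grp B n)) \<and>
     (\<forall>n. \<forall>c \<in> carrier (grp A n). bdry B n (f n c) = f (n - 1) (bdry A n c))"

definition homology :: "'c chain_data \<Rightarrow> int \<Rightarrow> 'c set monoid" where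
  "homology A n =
     (grp A n)\<lparr>carrier := kernel (grp A n) (grp A (n - 1)) (bdry A n)\<rparr>
       Mod (bdry A (n + 1) ` carrier (grp A (n + 1)))"

text \<open>The library's exact sequences live over a single carrier type, which excludes
  sequences ending in a quotient group; hence the following definition.\<close>

definition short_exact_complexes ::
  "'c chain_data \<Rightarrow> (int \<Rightarrow> 'c \<Rightarrow> 'd) \<Rightarrow> 'd chain_data \<Rightarrow> (int \<Rightarrow> 'd \<Rightarrow> 'e) \<Rightarrow> 'e chain_data \<Rightarrow> bool"
  where
  "short_exact_complexes A f B g C \<longleftrightarrow>
     chain_complex A \<and> chain_complex B \<and> chain_complex C \<and>
     chain_map A B f \<and> chain_map B C g \<and>
     (\<forall>n. f n \<in> mon (grp A n) (grp B n) \<and>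
          g n \<in> epi (grp B n) (grp C n) \<and>
          f n ` carrier (grp A n) = kernel (grp B n) (grp C n) (g n))"

text \<open>A splitting of a surjective chain map (the second map of a short exact sequence).\<close>

definition splitting_chain_map ::
  "'d chain_data \<Rightarrow> (int \<Rightarrow> 'd \<Rightarrow> 'e) \<Rightarrow> 'e chain_data \<Rightarrow> (int \<Rightarrow> 'e \<Rightarrow> 'd) \<Rightarrow> bool" where
  "splitting_chain_map B g C s \<longleftrightarrow>
     chain_map C B s \<and> (\<forall>n. \<forall>z \<in> carrier (grp C n). g n (s n z) = z)"

definition multispindle :: "'a set \<Rightarrow> nat \<Rightarrow> (nat \<Rightarrow> 'a \<Rightarrow> 'a \<Rightarrow> 'a) \<Rightarrow> bool" where
  "multispindle X k star \<longleftrightarrow>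
     (\<forall>r\<in>{1..k}. \<forall>x\<in>X. \<forall>y\<in>X. star r x y \<in> X) \<and>
     (\<forall>r\<in>{1..k}. \<forall>s\<in>{1..k}. \<forall>x\<in>X. \<forall>y\<in>X. \<forall>z\<in>X.
        star s (star r x y) z = star r (star s x z) (star s y z)) \<and>
     (\<forall>r\<in>{1..k}. \<forall>x\<in>X. star r x x = x)"

definition tuples :: "'a set \<Rightarrow> int \<Rightarrow> 'a list set" where
  "tuples X n = {xs. set xs \<subseteq> X \<and> xs \<noteq> [] \<and> int (length xs) = n + 1}"

text \<open>For i = 0 the first factor is empty, so this also covers the face map that
  just drops the first entry.\<close>

definition face :: "('a \<Rightarrow> 'a \<Rightarrow> 'a) \<Rightarrow> nat \<Rightarrow> 'a list \<Rightarrow> 'a list" where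
  "face f i xs = map (\<lambda>x. f x (xs ! i)) (take i xs) @ drop (Suc i) xs"

definition degeneracy :: "nat \<Rightarrow> 'a list \<Rightarrow> 'a list" where
  "degeneracy j xs = take (Suc j) xs @ drop j xs"

definition star_boundary ::
  "('a \<Rightarrow> 'a \<Rightarrow> 'a) \<Rightarrow> int \<Rightarrow> ('a list \<Rightarrow>\<^sub>0 int) \<Rightarrow> ('a list \<Rightarrow>\<^sub>0 int)" where
  "star_boundary f n c =
     (if n \<le> 0 then 0
      else frag_extend (\<lambda>xs. \<Sum>i\<le>nat n. frag_cmul ((- 1) ^ i) (frag_of (face f i xs))) c)"

definition multi_boundary ::
  "nat \<Rightarrow> (nat \<Rightarrow> 'a \<Rightarrow> 'a \<Rightarrow> 'a) \<Rightarrow> (nat \<Rightarrow> int) \<Rightarrow>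
   int \<Rightarrow> ('a list \<Rightarrow>\<^sub>0 int) \<Rightarrow> ('a list \<Rightarrow>\<^sub>0 int)" where
  "multi_boundary k star a n c = (\<Sum>r = 1..k. frag_cmul (a r) (star_boundary (star r) n c))"

definition multi_complex ::
  "'a set \<Rightarrow> nat \<Rightarrow> (nat \<Rightarrow> 'a \<Rightarrow> 'a \<Rightarrow> 'a) \<Rightarrow> (nat \<Rightarrow> int) \<Rightarrow> ('a list \<Rightarrow>\<^sub>0 int) chain_data" where
  "multi_complex X k star a =
     \<lparr>grp = (\<lambda>n. free_Abelian_group (tuples X n)), bdry = multi_boundary k star a\<rparr>"

definition degenerate_group :: "'a set \<Rightarrow> int \<Rightarrow> ('a list \<Rightarrow>\<^sub>0 int) monoid" where
  "degenerate_group X n =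
     subgroup_generated (free_Abelian_group (tuples X n))
       (\<Union>j<nat n. frag_extend (\<lambda>xs. frag_of (degeneracy j xs)) `
          carrier (free_Abelian_group (tuples X (n - 1))))"

definition degenerate_complex ::
  "'a set \<Rightarrow> nat \<Rightarrow> (nat \<Rightarrow> 'a \<Rightarrow> 'a \<Rightarrow> 'a) \<Rightarrow> (nat \<Rightarrow> int) \<Rightarrow> ('a list \<Rightarrow>\<^sub>0 int) chain_data" where
  "degenerate_complex X k star a =
     \<lparr>grp = degenerate_group X, bdry = multi_boundary k star a\<rparr>"

definition quotient_map ::
  "'a set \<Rightarrow> int \<Rightarrow> ('a list \<Rightarrow>\<^sub>0 int) \<Rightarrow> ('a list \<Rightarrow>\<^sub>0 int) set" where
  "quotient_map X n c =
     carrier (degenerate_group X n) #>\<^bsub>free_Abelian_group (tuples X n)\<^esub> c"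

text \<open>The boundary of a coset is the common coset of the boundaries of its elements.\<close>

definition normalized_complex ::
  "'a set \<Rightarrow> nat \<Rightarrow> (nat \<Rightarrow> 'a \<Rightarrow> 'a \<Rightarrow> 'a) \<Rightarrow> (nat \<Rightarrow> int) \<Rightarrow>
   ('a list \<Rightarrow>\<^sub>0 int) set chain_data" where
  "normalized_complex X k star a =
     \<lparr>grp = (\<lambda>n. free_Abelian_group (tuples X n) Mod carrier (degenerate_group X n)),
      bdry = (\<lambda>n z. the_elem ((\<lambda>c. quotient_map X (n - 1) (multi_boundary k star a n c)) ` z))\<rparr>"

text \<open>The multilinear expansion of a tuple whose entries are formal integer
  combinations of elements.\<close>

primrec multilinear :: "('a \<Rightarrow>\<^sub>0 int) list \<Rightarrow> ('a list \<Rightarrow>\<^sub>0 int)" where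
  "multilinear [] = frag_of []"
| "multilinear (c # cs) =
     frag_extend (\<lambda>x. frag_extend (\<lambda>xs. frag_of (x # xs)) (multilinear cs)) c"

definition alpha_tuple :: "'a list \<Rightarrow> ('a list \<Rightarrow>\<^sub>0 int)" where
  "alpha_tuple xs =
     multilinear (frag_of (xs ! 0) #
       map (\<lambda>i. frag_of (xs ! i) - frag_of (xs ! (i - 1))) [1..<length xs])"

end

theory Submission
  imports Defs
begin

text \<open>
  The map \<open>\<alpha>\<close> is treated as an endomorphism of the complex \<open>C(X)\<close> itself, and three of its
  properties carry the proof. It kills degenerate tuples, because an entry repeated
  next to itself gives a factor \<open>x - x = 0\<close> (\<open>alpha_word_degenerate\<close>). It differs from the identity by
  degenerate tuples only: in a term of the expansion other than the tuple itself, the first place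
  that contributes the preceding entry repeats it (\<open>keys_alpha_word_minus\<close>). It commutes with the
  boundary (\<open>boundary_alpha_word\<close>). The first two say that \<open>\<alpha>\<close> induces a section of
  \<open>C(X) \<rightarrow> C(X)/C\<^sup>D(X)\<close> on each group and that its kernel is \<open>C\<^sup>D(X)\<close>; with the third,
  \<open>C\<^sup>D(X)\<close> is a subcomplex, being the kernel of a chain map, and the section is a chain map.

  All statements about the boundary are proved by induction on words, removing the last letter. Write
  \<open>S\<^sub>y w = w y\<close> and \<open>w \<cdot> y\<close> for the combination, with coefficients \<open>a\<^sub>r\<close>, of the
  words obtained from \<open>w\<close> by applying \<open>\<star>\<^sub>r y\<close> to each letter. Then
  \<open>\<partial>(S\<^sub>y w) = S\<^sub>y (\<partial>w) \<plusminus> w \<cdot> y\<close>, the sign being that of the length of \<open>w\<close>, and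
  \<open>\<alpha>(S\<^sub>y w) = S\<^sub>y (\<alpha> w) - S\<^sub>x (\<alpha> w)\<close> if \<open>x\<close> is the last letter of \<open>w\<close>.
  Distributivity says that \<open>\<partial>\<close> commutes with \<open>\<cdot> y\<close>, which gives \<open>\<partial>\<partial> = 0\<close>.
  Idempotence, in the form \<open>(S\<^sub>x w) \<cdot> x = S\<^sub>x (w \<cdot> x)\<close>, makes the correction terms in
  \<open>\<partial>\<alpha> - \<alpha>\<partial>\<close> cancel.

  The decomposition of homology is then a general fact about split short exact sequences of
  complexes (\<open>homology_split_exact\<close>).
\<close>

section \<open>Homology of a split short exact sequence\<close>

definition cycle_group :: "'c chain_data \<Rightarrow> int \<Rightarrow> 'c monoid" where
  "cycle_group A n = (grp A n)\<lparr>carrier := kernel (grp A n) (grp A (n - 1)) (bdry A n)\<rparr>"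

definition boundaries :: "'c chain_data \<Rightarrow> int \<Rightarrow> 'c set" where
  "boundaries A n = bdry A (n + 1) ` carrier (grp A (n + 1))"

definition homology_class :: "'c chain_data \<Rightarrow> int \<Rightarrow> 'c \<Rightarrow> 'c set" where
  "homology_class A n c = boundaries A n #>\<^bsub>cycle_group A n\<^esub> c"

lemma homology_eq: "homology A n = cycle_group A n Mod boundaries A n"
  by (simp add: homology_def cycle_group_def boundaries_def)

lemma mult_cycle_group [simp]: "x \<otimes>\<^bsub>cycle_group A n\<^esub> y = x \<otimes>\<^bsub>grp A n\<^esub> y"
  and one_cycle_group [simp]: "\<one>\<^bsub>cycle_group A n\<^esub> = \<one>\<^bsub>grp A n\<^esub>"
  by (simp_all add: cycle_group_def)

lemma in_cycle_group_iff [simp]: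
  "c \<in> carrier (cycle_group A n) \<longleftrightarrow> c \<in> carrier (grp A n) \<and> bdry A n c = \<one>\<^bsub>grp A (n - 1)\<^esub>"
  by (simp add: cycle_group_def kernel_def)

context
  fixes A :: "'c chain_data"
  assumes A: "chain_complex A"
begin

lemma comm_group_grp: "comm_group (grp A n)"
  and bdry_hom: "bdry A n \<in> hom (grp A n) (grp A (n - 1))"
  and bdry_bdry: "c \<in> carrier (grp A n) \<Longrightarrow> bdry A (n - 1) (bdry A n c) = \<one>\<^bsub>grp A (n - 2)\<^esub>"
  using A by (auto simp: chain_complex_def)

lemma group_grp: "group (grp A n)"
  using comm_group_grp comm_group_def by blast

lemma group_hom_bdry: "group_hom (grp A n) (grp A (n - 1)) (bdry A n)"
  using group_grp bdry_hom by (simp add: group_hom_def group_hom_axioms_def)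

lemma comm_group_cycle_group: "comm_group (cycle_group A n)"
proof -
  interpret group_hom "grp A n" "grp A (n - 1)" "bdry A n"
    by (rule group_hom_bdry)
  show ?thesis
    using group.subgroup_imp_group[OF group_grp subgroup_kernel] comm_groupE(4)[OF comm_group_grp]
    unfolding cycle_group_def by (intro group.group_comm_groupI) (auto simp: kernel_def)
qed

lemma subgroup_boundaries: "subgroup (boundaries A n) (cycle_group A n)"
proof -
  have sub: "subgroup (boundaries A n) (grp A n)"
    using group_hom.img_is_subgroup[OF group_hom_bdry[of "n + 1"]] by (simp add: boundaries_def)
  have "boundaries A n \<subseteq> kernel (grp A n) (grp A (n - 1)) (bdry A n)"
    using bdry_bdry[of _ "n + 1"] subgroup.subset[OF sub] by (auto simp: boundaries_def kernel_def)
  then show ?thesis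
    using group.subgroup_incl[OF group_grp sub group_hom.subgroup_kernel[OF group_hom_bdry]]
    by (simp add: cycle_group_def)
qed

lemma normal_boundaries: "boundaries A n \<lhd> cycle_group A n"
  using comm_group.subgroup_imp_normal[OF comm_group_cycle_group subgroup_boundaries] .

lemma group_homology: "group (homology A n)"
  using normal.factorgroup_is_group[OF normal_boundaries] by (simp add: homology_eq)

lemma homology_class_hom: "homology_class A n \<in> hom (cycle_group A n) (homology A n)"
  using normal.r_coset_hom_Mod[OF normal_boundaries, of n]
  unfolding homology_class_def homology_eq .

lemma carrier_homology:
  "carrier (homology A n) = homology_class A n ` carrier (cycle_group A n)"
  by (simp add: homology_eq carrier_FactGroup homology_class_def)

lemma homology_class_eq_one_iff:
  assumes "c \<in> carrier (cycle_group A n)"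
  shows "homology_class A n c = \<one>\<^bsub>homology A n\<^esub> \<longleftrightarrow> c \<in> boundaries A n"
proof -
  have G: "group (cycle_group A n)"
    using comm_group_cycle_group comm_group_def by blast
  show ?thesis
    using group.coset_join1[OF G _ assms subgroup_boundaries]
      group.coset_join2[OF G assms subgroup_boundaries]
    by (auto simp: homology_class_def homology_eq)
qed

end

lemma chain_map_hom_cycle_group:
  assumes "chain_complex A" "chain_complex B" "chain_map A B f"
  shows "f n \<in> hom (cycle_group A n) (cycle_group B n)"
proof -
  have f: "f m \<in> hom (grp A m) (grp B m)"
    and d: "c \<in> carrier (grp A m) \<Longrightarrow> bdry B m (f m c) = f (m - 1) (bdry A m c)" for m c
    using assms(3) by (auto simp: chain_map_def)
  have "f (n - 1) \<one>\<^bsub>grp A (n - 1)\<^esub> = \<one>\<^bsub>grp B (n - 1)\<^esub>"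
    using f group_grp assms by (metis hom_one)
  then show ?thesis
    using f[of n] d by (intro homI) (auto simp: hom_mult hom_in_carrier)
qed

lemma chain_map_boundaries:
  assumes "chain_map A B f" "c \<in> boundaries A n"
  shows "f n c \<in> boundaries B n"
proof -
  obtain b where b: "b \<in> carrier (grp A (n + 1))" "c = bdry A (n + 1) b"
    using assms(2) by (auto simp: boundaries_def)
  have "f (n + 1) \<in> hom (grp A (n + 1)) (grp B (n + 1))"
    using assms(1) by (simp add: chain_map_def)
  then have "f (n + 1) b \<in> carrier (grp B (n + 1))"
    using b by (simp add: hom_in_carrier)
  moreover have "bdry B (n + 1) (f (n + 1) b) = f (n + 1 - 1) (bdry A (n + 1) b)"
    using assms(1) b(1) unfolding chain_map_def by blast
  ultimately show ?thesis
    unfolding boundaries_def using b(2) by (metis add_diff_cancel_right' imageI)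
qed

text \<open>For a section \<open>s\<close> of \<open>g\<close> the endomorphism \<open>q c = c - s (g c)\<close> lands in the kernel of \<open>g\<close>, which
  is the image of the injection \<open>f\<close>; pulling it back along \<open>f\<close> yields the retraction. It is a chain
  map because \<open>q\<close> is one and \<open>f\<close> is injective.\<close>

lemma split_exact_retraction:
  assumes exact: "short_exact_complexes A f B g C"
    and split: "splitting_chain_map B g C s"
  obtains p where "chain_map B A p"
    and "\<And>n c. c \<in> carrier (grp B n) \<Longrightarrow> f n (p n c) \<otimes>\<^bsub>grp B n\<^esub> s n (g n c) = c"
    and "\<And>n x z. x \<in> carrier (grp A n) \<Longrightarrow> z \<in> carrier (grp C n) \<Longrightarrow>
           p n (f n x \<otimes>\<^bsub>grp B n\<^esub> s n z) = x"
proof -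
  have A: "chain_complex A" and B: "chain_complex B" and C: "chain_complex C"
    and f: "chain_map A B f" and g: "chain_map B C g" and s: "chain_map C B s"
    using exact split by (auto simp: short_exact_complexes_def splitting_chain_map_def)
  note groups = group_grp[OF A] group_grp[OF B] group_grp[OF C]
  have fh: "f n \<in> hom (grp A n) (grp B n)" and gh: "g n \<in> hom (grp B n) (grp C n)"
    and sh: "s n \<in> hom (grp C n) (grp B n)" for n
    using f g s by (auto simp: chain_map_def)
  have fd: "bdry B n (f n x) = f (n - 1) (bdry A n x)" if "x \<in> carrier (grp A n)" for n x
    using f that by (simp add: chain_map_def)
  have gd: "bdry C n (g n x) = g (n - 1) (bdry B n x)" if "x \<in> carrier (grp B n)" for n x
    using g that by (simp add: chain_map_def)
  have sd: "bdry B n (s n x) = s (n - 1) (bdry C n x)" if "x \<in> carrier (grp C n)" for n x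
    using s that by (simp add: chain_map_def)
  have inj: "inj_on (f n) (carrier (grp A n))" for n
    using exact by (auto simp: short_exact_complexes_def mon_def)
  have im: "f n ` carrier (grp A n) = kernel (grp B n) (grp C n) (g n)" for n
    using exact by (simp add: short_exact_complexes_def)
  have gs: "g n (s n z) = z" if "z \<in> carrier (grp C n)" for n z
    using split that by (simp add: splitting_chain_map_def)
  define q where "q n c = c \<otimes>\<^bsub>grp B n\<^esub> inv\<^bsub>grp B n\<^esub> s n (g n c)" for n c
  define p where "p n c = inv_into (carrier (grp A n)) (f n) (q n c)" for n c
  have qh: "q n \<in> hom (grp B n) (grp B n)" for n
  proof -
    interpret comm_group "grp B n" by (rule comm_group_grp[OF B])
    have "(\<lambda>c. s n (g n c)) \<in> hom (grp B n) (grp B n)"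
      using Group.hom_compose[OF gh sh] by (simp add: o_def)
    then show ?thesis
      unfolding q_def by (auto simp: hom_def Pi_iff m_ac inv_mult)
  qed
  have gq: "g n (q n c) = \<one>\<^bsub>grp C n\<^esub>" if c: "c \<in> carrier (grp B n)" for n c
  proof -
    interpret group_hom "grp B n" "grp C n" "g n"
      using groups gh by (simp add: group_hom_def group_hom_axioms_def)
    have "s n (g n c) \<in> carrier (grp B n)"
      using c sh hom_in_carrier by (metis hom_closed)
    then show ?thesis
      using c gs by (simp add: q_def)
  qed
  have qim: "q n c \<in> f n ` carrier (grp A n)" if "c \<in> carrier (grp B n)" for n c
    using that gq qh hom_in_carrier[OF qh] unfolding im kernel_def by auto
  have pA: "p n c \<in> carrier (grp A n)" and fp: "f n (p n c) = q n c"
    if "c \<in> carrier (grp B n)" for n c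
    using qim[OF that] by (simp_all add: p_def inv_into_into f_inv_into_f)
  have pI: "p n c = x" if "x \<in> carrier (grp A n)" "c \<in> carrier (grp B n)" "f n x = q n c" for n c x
    using that inj fp pA by (metis inj_onD)
  have ph: "p n \<in> hom (grp B n) (grp A n)" for n
  proof (rule homI)
    fix b c assume bc: "b \<in> carrier (grp B n)" "c \<in> carrier (grp B n)"
    have "p n b \<otimes>\<^bsub>grp A n\<^esub> p n c \<in> carrier (grp A n)"
      using groups pA bc by (simp add: group.is_monoid monoid.m_closed)
    moreover have "b \<otimes>\<^bsub>grp B n\<^esub> c \<in> carrier (grp B n)"
      using groups bc by (simp add: group.is_monoid monoid.m_closed)
    moreover have "f n (p n b \<otimes>\<^bsub>grp A n\<^esub> p n c) = q n (b \<otimes>\<^bsub>grp B n\<^esub> c)"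
      using bc pA fp by (simp add: hom_mult[OF fh] hom_mult[OF qh])
    ultimately show "p n (b \<otimes>\<^bsub>grp B n\<^esub> c) = p n b \<otimes>\<^bsub>grp A n\<^esub> p n c"
      by (rule pI)
  qed (rule pA)
  have qd: "bdry B n (q n c) = q (n - 1) (bdry B n c)" if c: "c \<in> carrier (grp B n)" for n c
  proof -
    interpret group_hom "grp B n" "grp B (n - 1)" "bdry B n"
      by (rule group_hom_bdry[OF B])
    have "g n c \<in> carrier (grp C n)" "s n (g n c) \<in> carrier (grp B n)"
      using c sh gh hom_in_carrier by metis+
    then show ?thesis
      using c by (simp add: q_def sd gd)
  qed
  have "chain_map B A p"
    unfolding chain_map_def
  proof (intro conjI allI ballI)
    fix n c assume c: "c \<in> carrier (grp B n)"
    have "bdry A n (p n c) \<in> carrier (grp A (n - 1))" "bdry B n c \<in> carrier (grp B (n - 1))"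
      using c pA bdry_hom[OF A] bdry_hom[OF B] hom_in_carrier by metis+
    moreover have "f (n - 1) (bdry A n (p n c)) = q (n - 1) (bdry B n c)"
      using c pA fp by (simp add: qd flip: fd)
    ultimately show "bdry A n (p n c) = p (n - 1) (bdry B n c)"
      by (rule pI[symmetric])
  qed (rule ph)
  moreover have "f n (p n c) \<otimes>\<^bsub>grp B n\<^esub> s n (g n c) = c" if c: "c \<in> carrier (grp B n)" for n c
  proof -
    interpret group "grp B n" by (rule groups)
    have "s n (g n c) \<in> carrier (grp B n)"
      using c sh gh hom_in_carrier by metis
    then show ?thesis
      using c by (simp add: fp q_def m_assoc)
  qed
  moreover have "p n (f n x \<otimes>\<^bsub>grp B n\<^esub> s n z) = x"
    if x: "x \<in> carrier (grp A n)" and z: "z \<in> carrier (grp C n)" for n x z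
  proof -
    interpret group_hom "grp B n" "grp C n" "g n"
      using groups gh by (simp add: group_hom_def group_hom_axioms_def)
    have fx: "f n x \<in> carrier (grp B n)" and sz: "s n z \<in> carrier (grp B n)"
      using x z fh sh hom_in_carrier by metis+
    have "g n (f n x) = \<one>\<^bsub>grp C n\<^esub>"
      using im[of n] x by (auto simp: kernel_def)
    then have "f n x = q n (f n x \<otimes>\<^bsub>grp B n\<^esub> s n z)"
      using fx sz z gs by (simp add: q_def G.m_assoc)
    then show ?thesis
      using x fx sz by (intro pI) simp_all
  qed
  ultimately show thesis
    using that by blast
qed

text \<open>Let \<open>p\<close> be the retraction complementary to \<open>s\<close>. Taking the classes of \<open>p c\<close> and \<open>g c\<close> maps the cycles of \<open>B\<close> onto the product. Since
  \<open>c = f (p c) + s (g c)\<close> and all four maps preserve boundaries, the kernel consists of the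
  boundaries of \<open>B\<close>, and the first isomorphism theorem applies.\<close>

lemma homology_split_exact:
  assumes exact: "short_exact_complexes A f B g C"
    and split: "splitting_chain_map B g C s"
  shows "homology B n \<cong> homology A n \<times>\<times> homology C n"
proof -
  have A: "chain_complex A" and B: "chain_complex B" and C: "chain_complex C"
    and f: "chain_map A B f" and g: "chain_map B C g" and s: "chain_map C B s"
    using exact split by (auto simp: short_exact_complexes_def splitting_chain_map_def)
  obtain p where p: "chain_map B A p"
    and dec: "\<And>n c. c \<in> carrier (grp B n) \<Longrightarrow> f n (p n c) \<otimes>\<^bsub>grp B n\<^esub> s n (g n c) = c"
    and pI: "\<And>n x z. x \<in> carrier (grp A n) \<Longrightarrow> z \<in> carrier (grp C n) \<Longrightarrow>
           p n (f n x \<otimes>\<^bsub>grp B n\<^esub> s n z) = x"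
    using split_exact_retraction[OF exact split] by metis
  have gI: "g n (f n x \<otimes>\<^bsub>grp B n\<^esub> s n z) = z"
    if x: "x \<in> carrier (grp A n)" and z: "z \<in> carrier (grp C n)" for x z
  proof -
    interpret group_hom "grp B n" "grp C n" "g n"
      using group_grp[OF B] group_grp[OF C] g
      by (simp add: group_hom_def group_hom_axioms_def chain_map_def)
    have "f n ` carrier (grp A n) = kernel (grp B n) (grp C n) (g n)"
      using exact by (simp add: short_exact_complexes_def)
    then have "f n x \<in> carrier (grp B n)" "g n (f n x) = \<one>\<^bsub>grp C n\<^esub>"
      using x by (auto simp: kernel_def)
    moreover have "s n z \<in> carrier (grp B n)" "g n (s n z) = z"
      using z split hom_in_carrier[of "s n"] by (auto simp: splitting_chain_map_def chain_map_def)
    ultimately show ?thesis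
      using z by simp
  qed
  let ?H = "homology A n \<times>\<times> homology C n"
  define \<phi> where "\<phi> c = (homology_class A n (p n c), homology_class C n (g n c))" for c
  note cyc = chain_map_hom_cycle_group[OF B A p, of n] chain_map_hom_cycle_group[OF B C g, of n]
    chain_map_hom_cycle_group[OF A B f, of n] chain_map_hom_cycle_group[OF C B s, of n]
  have "\<phi> \<in> hom (cycle_group B n) ?H"
    using hom_compose[OF cyc(1) homology_class_hom[OF A]] hom_compose[OF cyc(2) homology_class_hom[OF C]]
    by (simp add: \<phi>_def[abs_def] hom_paired o_def)
  then interpret \<phi>: group_hom "cycle_group B n" ?H \<phi>
    using comm_group_cycle_group[OF B] group_homology[OF A] group_homology[OF C]
    by (simp add: group_hom_def group_hom_axioms_def DirProd_group comm_group_def)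
  have "\<phi> ` carrier (cycle_group B n) = carrier ?H"
  proof
    show "\<phi> ` carrier (cycle_group B n) \<subseteq> carrier ?H"
      using \<phi>.hom_closed by blast
    show "carrier ?H \<subseteq> \<phi> ` carrier (cycle_group B n)"
    proof
      fix u assume "u \<in> carrier ?H"
      then obtain x z where u: "u = (homology_class A n x, homology_class C n z)"
        and xz: "x \<in> carrier (cycle_group A n)" "z \<in> carrier (cycle_group C n)"
        by (auto simp: carrier_homology[OF A] carrier_homology[OF C] simp del: in_cycle_group_iff)
      let ?c = "f n x \<otimes>\<^bsub>grp B n\<^esub> s n z"
      have "f n x \<otimes>\<^bsub>cycle_group B n\<^esub> s n z \<in> carrier (cycle_group B n)"
        using hom_in_carrier[OF cyc(3) xz(1)] hom_in_carrier[OF cyc(4) xz(2)] by (rule \<phi>.G.m_closed)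
      moreover have "\<phi> ?c = u"
        using xz by (simp add: \<phi>_def u pI gI)
      ultimately show "u \<in> \<phi> ` carrier (cycle_group B n)"
        unfolding mult_cycle_group by blast
    qed
  qed
  then have "cycle_group B n Mod kernel (cycle_group B n) ?H \<phi> \<cong> ?H"
    by (rule \<phi>.FactGroup_iso)
  moreover have "kernel (cycle_group B n) ?H \<phi> = boundaries B n"
  proof
    show "boundaries B n \<subseteq> kernel (cycle_group B n) ?H \<phi>"
    proof
      fix c assume c: "c \<in> boundaries B n"
      have "c \<in> carrier (cycle_group B n)"
        using subgroup.mem_carrier[OF subgroup_boundaries[OF B] c] .
      then show "c \<in> kernel (cycle_group B n) ?H \<phi>"
        using chain_map_boundaries[OF p c] chain_map_boundaries[OF g c]
          homology_class_eq_one_iff[OF A hom_in_carrier[OF cyc(1)]]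
          homology_class_eq_one_iff[OF C hom_in_carrier[OF cyc(2)]]
        by (simp add: kernel_def \<phi>_def del: in_cycle_group_iff)
    qed
    show "kernel (cycle_group B n) ?H \<phi> \<subseteq> boundaries B n"
    proof
      fix c assume "c \<in> kernel (cycle_group B n) ?H \<phi>"
      then have c: "c \<in> carrier (cycle_group B n)"
        and "p n c \<in> boundaries A n" "g n c \<in> boundaries C n"
        using homology_class_eq_one_iff[OF A hom_in_carrier[OF cyc(1)]]
          homology_class_eq_one_iff[OF C hom_in_carrier[OF cyc(2)]]
        by (auto simp: kernel_def \<phi>_def simp del: in_cycle_group_iff)
      then have "f n (p n c) \<otimes>\<^bsub>cycle_group B n\<^esub> s n (g n c) \<in> boundaries B n"
        using chain_map_boundaries[OF f] chain_map_boundaries[OF s]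
        by (intro subgroup.m_closed[OF subgroup_boundaries[OF B]])
      then show "c \<in> boundaries B n"
        using dec[of c n] c by simp
    qed
  qed
  ultimately show ?thesis
    by (simp add: homology_eq)
qed

section \<open>Chains of words\<close>

definition snoc :: "'a \<Rightarrow> ('a list \<Rightarrow>\<^sub>0 int) \<Rightarrow> ('a list \<Rightarrow>\<^sub>0 int)" where
  "snoc y = frag_extend (\<lambda>xs. frag_of (xs @ [y]))"

definition push :: "('a \<Rightarrow> 'b) \<Rightarrow> ('a list \<Rightarrow>\<^sub>0 int) \<Rightarrow> ('b list \<Rightarrow>\<^sub>0 int)" where
  "push h = frag_extend (\<lambda>xs. frag_of (map h xs))"

text \<open>This is the augmented boundary: a one-letter word has the empty word as its only face. Keeping
  that term lets the recursion on the last letter start at the empty word; the complex itself only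
  uses this boundary in positive degrees.\<close>

definition word_boundary :: "('a \<Rightarrow> 'a \<Rightarrow> 'a) \<Rightarrow> 'a list \<Rightarrow> ('a list \<Rightarrow>\<^sub>0 int)" where
  "word_boundary f xs = (\<Sum>i<length xs. frag_cmul ((- 1) ^ i) (frag_of (face f i xs)))"

lemma snoc_simps [simp]:
  "snoc y 0 = 0" "snoc y (frag_of xs) = frag_of (xs @ [y])"
  "snoc y (b + c) = snoc y b + snoc y c" "snoc y (b - c) = snoc y b - snoc y c"
  "snoc y (- c) = - snoc y c" "snoc y (frag_cmul m c) = frag_cmul m (snoc y c)"
  by (simp_all add: snoc_def frag_extend_add frag_extend_diff frag_extend_minus frag_extend_cmul)

lemma push_simps [simp]:
  "push h 0 = 0" "push h (frag_of xs) = frag_of (map h xs)"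
  "push h (b + c) = push h b + push h c" "push h (b - c) = push h b - push h c"
  "push h (- c) = - push h c" "push h (frag_cmul m c) = frag_cmul m (push h c)"
  by (simp_all add: push_def frag_extend_add frag_extend_diff frag_extend_minus frag_extend_cmul)

lemma snoc_sum: "finite I \<Longrightarrow> snoc y (sum g I) = (\<Sum>i\<in>I. snoc y (g i))"
  by (simp add: snoc_def frag_extend_sum o_def)

lemma push_sum: "finite I \<Longrightarrow> push h (sum g I) = (\<Sum>i\<in>I. push h (g i))"
  by (simp add: push_def frag_extend_sum o_def)

lemma keys_snoc: "Poly_Mapping.keys (snoc y c) \<subseteq> (\<lambda>xs. xs @ [y]) ` Poly_Mapping.keys c"
  using keys_frag_extend[of "\<lambda>xs. frag_of (xs @ [y])" c] by (auto simp: snoc_def)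

lemma push_snoc: "push h (snoc y c) = snoc (h y) (push h c)"
  by (induction c rule: frag_induction[OF subset_UNIV]) simp_all

lemma face_length: "i < length xs \<Longrightarrow> length (face f i xs) = length xs - 1"
  by (simp add: face_def)

lemma face_snoc:
  "i < length xs \<Longrightarrow> face f i (xs @ [y]) = face f i xs @ [y]"
  "face f (length xs) (xs @ [y]) = map (\<lambda>x. f x y) xs"
  by (simp_all add: face_def nth_append)

lemma face_map:
  assumes "i < length xs"
    and "\<And>x y. x \<in> set xs \<Longrightarrow> y \<in> set xs \<Longrightarrow> h (f x y) = f (h x) (h y)"
  shows "face f i (map h xs) = map h (face f i xs)"
proof -
  have "x \<in> set xs" if "x \<in> set (take i xs)" for x
    using that by (meson in_set_takeD)
  moreover have "xs ! i \<in> set xs"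
    using assms(1) by simp
  ultimately show ?thesis
    using assms by (auto simp: face_def take_map drop_map)
qed

lemma word_boundary_Nil [simp]: "word_boundary f [] = 0"
  by (simp add: word_boundary_def)

text \<open>A face of \<open>xs @ [y]\<close> at a letter of \<open>xs\<close> leaves \<open>y\<close> in place, and the face at \<open>y\<close> lets \<open>y\<close> act
  on all of \<open>xs\<close>.\<close>

lemma word_boundary_snoc:
  "word_boundary f (xs @ [y]) =
     snoc y (word_boundary f xs) + frag_cmul ((- 1) ^ length xs) (frag_of (map (\<lambda>x. f x y) xs))"
  by (simp add: word_boundary_def snoc_sum face_snoc)

lemma word_boundary_map:
  assumes "\<And>x y. x \<in> set xs \<Longrightarrow> y \<in> set xs \<Longrightarrow> h (f x y) = f (h x) (h y)"
  shows "word_boundary f (map h xs) = push h (word_boundary f xs)"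
proof -
  have "face f i (map h xs) = map h (face f i xs)" if "i < length xs" for i
    using face_map[of i xs h f] that assms by simp
  then show ?thesis
    by (simp add: word_boundary_def push_sum)
qed

lemma keys_sum_subset:
  fixes g :: "'b \<Rightarrow> 'c \<Rightarrow>\<^sub>0 int"
  assumes "\<And>i. i \<in> I \<Longrightarrow> Poly_Mapping.keys (g i) \<subseteq> S"
  shows "Poly_Mapping.keys (sum g I) \<subseteq> S"
  using sum_closed_free_Abelian_group[of I g S] assms unfolding carrier_free_Abelian_group_iff .

lemma keys_extend_subset:
  assumes "Poly_Mapping.keys c \<subseteq> S" and "\<And>x. x \<in> S \<Longrightarrow> Poly_Mapping.keys (g x) \<subseteq> T"
  shows "Poly_Mapping.keys (frag_extend g c) \<subseteq> T"
  using keys_frag_extend[of g c] assms by blast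

section \<open>The multilinear map on words\<close>

text \<open>The empty word is set apart because \<open>alpha_tuple\<close> reads a first entry. The value chosen for it
  makes the multilinear map compatible with the augmented boundary.\<close>

definition alpha_word :: "'a list \<Rightarrow> ('a list \<Rightarrow>\<^sub>0 int)" where
  "alpha_word xs = (if xs = [] then frag_of [] else alpha_tuple xs)"

definition alpha :: "('a list \<Rightarrow>\<^sub>0 int) \<Rightarrow> ('a list \<Rightarrow>\<^sub>0 int)" where
  "alpha = frag_extend alpha_word"

lemma alpha_simps [simp]:
  "alpha 0 = 0" "alpha (frag_of xs) = alpha_word xs"
  "alpha (b + c) = alpha b + alpha c" "alpha (b - c) = alpha b - alpha c"
  "alpha (- c) = - alpha c" "alpha (frag_cmul m c) = frag_cmul m (alpha c)"
  by (simp_all add: alpha_def frag_extend_add frag_extend_diff frag_extend_minus frag_extend_cmul)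

lemma multilinear_snoc_diff:
  "multilinear (cs @ [frag_of y - frag_of x]) = snoc y (multilinear cs) - snoc x (multilinear cs)"
proof (induction cs)
  case Nil
  show ?case by (simp add: frag_extend_diff)
next
  case (Cons b cs)
  define cons where "cons z = frag_extend (\<lambda>xs. frag_of (z # xs))" for z :: 'a
  have cons_diff: "cons z (d - e) = cons z d - cons z e" for z d e
    by (simp add: cons_def frag_extend_diff)
  have cons_snoc: "cons z (snoc v d) = snoc v (cons z d)" for z v d
    by (induction d rule: frag_induction[OF subset_UNIV]) (simp_all add: cons_def frag_extend_diff)
  have "frag_extend (\<lambda>z. cons z (snoc y d - snoc x d)) b
      = snoc y (frag_extend (\<lambda>z. cons z d) b) - snoc x (frag_extend (\<lambda>z. cons z d) b)" for d
    by (induction b rule: frag_induction[OF subset_UNIV])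
       (simp_all add: frag_extend_diff cons_diff cons_snoc)
  then show ?case
    using Cons by (simp flip: cons_def)
qed

lemma alpha_word_Nil [simp]: "alpha_word [] = frag_of []"
  by (simp add: alpha_word_def)

text \<open>Only the last factor \<open>y - x\<close> of the tensor involves \<open>y\<close>; expanding it leaves the
  expansion of the shorter word, followed by \<open>y\<close> or by its own last letter.\<close>

lemma alpha_word_snoc:
  "alpha_word (xs @ [y]) =
     snoc y (alpha_word xs) - (if xs = [] then 0 else snoc (last xs) (alpha_word xs))"
proof (cases xs rule: rev_cases)
  case Nil
  then show ?thesis
    by (simp add: alpha_word_def alpha_tuple_def)
next
  case (snoc v x)
  have "[1..<length (xs @ [y])] = [1..<length xs] @ [length xs]"
    using snoc by simp
  moreover have "map (\<lambda>i. frag_of ((xs @ [y]) ! i) - frag_of ((xs @ [y]) ! (i - 1))) [1..<length xs]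
      = map (\<lambda>i. frag_of (xs ! i) - frag_of (xs ! (i - 1))) [1..<length xs]"
    by (auto simp: nth_append)
  moreover have "(xs @ [y]) ! 0 = xs ! 0" "(xs @ [y]) ! length xs = y"
    "(xs @ [y]) ! (length xs - 1) = last xs"
    using snoc by (simp_all add: nth_append)
  ultimately have "alpha_tuple (xs @ [y]) =
      multilinear ((frag_of (xs ! 0) # map (\<lambda>i. frag_of (xs ! i) - frag_of (xs ! (i - 1))) [1..<length xs])
        @ [frag_of y - frag_of (last xs)])"
    unfolding alpha_tuple_def by (simp only: map_append list.map append_Cons)
  then show ?thesis
    using snoc unfolding multilinear_snoc_diff by (simp add: alpha_word_def alpha_tuple_def)
qed

lemma alpha_snoc_snoc:
  "alpha (snoc y (snoc x c)) = snoc y (alpha (snoc x c)) - snoc x (alpha (snoc x c))"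
proof (induction c rule: frag_induction[OF subset_UNIV])
  case (2 xs)
  show ?case
    using alpha_word_snoc[of "xs @ [x]" y] by simp
next
  case (3 b c)
  then show ?case
    by (simp only: alpha_simps snoc_simps) (simp add: algebra_simps)
qed simp

lemma diff_diff_swap: "(p - q) - (r - s) = (p - r) - (q - (s :: 'b :: ab_group_add))"
  by (simp add: algebra_simps)

text \<open>On a word \<open>w\<close> both sides are the term in which the last letter of \<open>w\<close> is appended, and that
  term does not depend on the letter that follows \<open>w\<close>. In the comparison of \<open>\<partial>\<alpha>\<close> with
  \<open>\<alpha>\<partial>\<close> this relates words that differ in the final letter.\<close>

lemma alpha_last_independent:
  "alpha (snoc y c) - snoc y (alpha c) = alpha (snoc x c) - snoc x (alpha c)"
proof (induction c rule: frag_induction[OF subset_UNIV])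
  case (3 b c)
  then show ?case
    by (simp only: alpha_simps snoc_simps, subst (1 2) diff_diff_swap) (simp only:)
qed (simp_all add: alpha_word_snoc)

text \<open>Naturality: the formula for \<open>\<alpha>\<close> refers to the positions of the letters only.\<close>

lemma alpha_push: "alpha (push h c) = push h (alpha c)"
proof -
  have "alpha_word (map h xs) = push h (alpha_word xs)" for xs
    by (induction xs rule: rev_induct) (simp_all add: alpha_word_snoc push_snoc last_map)
  then show ?thesis
    by (induction c rule: frag_induction[OF subset_UNIV]) simp_all
qed

text \<open>If the last two letters agree, the two terms of the recursion cancel; otherwise the repetition
  occurs already in the shorter word.\<close>

lemma alpha_word_degenerate:
  "\<not> distinct_adj xs \<Longrightarrow> alpha_word xs = 0"
proof (induction xs rule: rev_induct)
  case (snoc y xs)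
  then show ?case
    by (cases "distinct_adj xs") (auto simp: alpha_word_snoc distinct_adj_append_iff)
qed simp

text \<open>By the recursion the error term for \<open>xs @ [y]\<close> is the error term for \<open>xs\<close>, extended by a
  letter and so still degenerate, together with \<open>xs\<close> followed by its own last letter.\<close>

lemma keys_alpha_word_minus:
  "Poly_Mapping.keys (alpha_word xs - frag_of xs)
     \<subseteq> {ys. length ys = length xs \<and> set ys \<subseteq> set xs \<and> \<not> distinct_adj ys}"
proof (induction xs rule: rev_induct)
  case (snoc y xs)
  let ?d = "alpha_word xs - frag_of xs"
  let ?T = "{ys. length ys = length (xs @ [y]) \<and> set ys \<subseteq> set (xs @ [y]) \<and> \<not> distinct_adj ys}"
  have step: "Poly_Mapping.keys (snoc z ?d) \<subseteq> ?T" if "z \<in> set (xs @ [y])" for z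
    using keys_snoc[of z ?d] snoc that by (fastforce simp: distinct_adj_append_iff)
  show ?case
  proof (cases "xs = []")
    case True
    then show ?thesis by (simp add: alpha_word_def alpha_tuple_def)
  next
    case False
    let ?x = "last xs"
    have "alpha_word (xs @ [y]) - frag_of (xs @ [y]) = snoc y ?d - (snoc ?x ?d + frag_of (xs @ [?x]))"
      using False by (simp add: alpha_word_snoc)
    moreover have "frag_of (xs @ [?x]) \<in> carrier (free_Abelian_group ?T)"
      using False by (auto simp: distinct_adj_append_iff)
    moreover have "Poly_Mapping.keys (snoc y ?d) \<subseteq> ?T" "Poly_Mapping.keys (snoc ?x ?d) \<subseteq> ?T"
      using step False by simp_all
    ultimately show ?thesis
      using keys_diff[of "snoc y ?d" "snoc ?x ?d + frag_of (xs @ [?x])"]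
        keys_add[of "snoc ?x ?d" "frag_of (xs @ [?x])"]
      by (simp only: carrier_free_Abelian_group_iff) (meson Un_least order_trans)
  qed
qed simp

lemma keys_alpha_word:
  "Poly_Mapping.keys (alpha_word xs) \<subseteq> {ys. length ys = length xs \<and> set ys \<subseteq> set xs}"
  using keys_alpha_word_minus[of xs] keys_add[of "alpha_word xs - frag_of xs" "frag_of xs"]
  by auto

section \<open>The boundary of a multispindle\<close>

locale multispindle_chains =
  fixes X :: "'a set" and k :: nat and star :: "nat \<Rightarrow> 'a \<Rightarrow> 'a \<Rightarrow> 'a" and a :: "nat \<Rightarrow> int"
  assumes multispindle: "multispindle X k star"
begin

lemma star_closed: "\<lbrakk>r \<in> {1..k}; x \<in> X; y \<in> X\<rbrakk> \<Longrightarrow> star r x y \<in> X"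
  and star_distrib: "\<lbrakk>r \<in> {1..k}; s \<in> {1..k}; x \<in> X; y \<in> X; z \<in> X\<rbrakk>
        \<Longrightarrow> star s (star r x y) z = star r (star s x z) (star s y z)"
  and star_idem: "\<lbrakk>r \<in> {1..k}; x \<in> X\<rbrakk> \<Longrightarrow> star r x x = x"
  using multispindle unfolding multispindle_def by blast+

text \<open>The scalars are absorbed into the boundary and into the action of a letter from the beginning,
  so that the sum over the operations has to be handled only where distributivity and
  idempotence are used.\<close>

definition multi_word_boundary :: "'a list \<Rightarrow> ('a list \<Rightarrow>\<^sub>0 int)" where
  "multi_word_boundary xs = (\<Sum>r = 1..k. frag_cmul (a r) (word_boundary (star r) xs))"

definition word_act :: "'a \<Rightarrow> 'a list \<Rightarrow> ('a list \<Rightarrow>\<^sub>0 int)" where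
  "word_act y xs = (\<Sum>r = 1..k. frag_cmul (a r) (frag_of (map (\<lambda>x. star r x y) xs)))"

definition boundary :: "('a list \<Rightarrow>\<^sub>0 int) \<Rightarrow> ('a list \<Rightarrow>\<^sub>0 int)" where
  "boundary = frag_extend multi_word_boundary"

definition act :: "'a \<Rightarrow> ('a list \<Rightarrow>\<^sub>0 int) \<Rightarrow> ('a list \<Rightarrow>\<^sub>0 int)" where
  "act y = frag_extend (word_act y)"

lemma boundary_simps [simp]:
  "boundary 0 = 0" "boundary (frag_of xs) = multi_word_boundary xs"
  "boundary (b + c) = boundary b + boundary c" "boundary (b - c) = boundary b - boundary c"
  "boundary (- c) = - boundary c" "boundary (frag_cmul m c) = frag_cmul m (boundary c)"
  by (simp_all add: boundary_def frag_extend_add frag_extend_diff frag_extend_minus frag_extend_cmul)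

lemma act_simps [simp]:
  "act y 0 = 0" "act y (frag_of xs) = word_act y xs"
  "act y (b + c) = act y b + act y c" "act y (b - c) = act y b - act y c"
  "act y (- c) = - act y c" "act y (frag_cmul m c) = frag_cmul m (act y c)"
  by (simp_all add: act_def frag_extend_add frag_extend_diff frag_extend_minus frag_extend_cmul)

lemma frag_cmul_diff: "frag_cmul m (b - c) = frag_cmul m b - frag_cmul m c"
  by (rule poly_mapping_eqI) (simp add: lookup_minus right_diff_distrib)

lemma boundary_altdef:
  "boundary c = (\<Sum>r = 1..k. frag_cmul (a r) (frag_extend (word_boundary (star r)) c))"
  by (induction c rule: frag_induction[OF subset_UNIV])
     (simp_all add: multi_word_boundary_def frag_extend_diff frag_cmul_diff sum_subtractf)

lemma act_altdef: "act y c = (\<Sum>r = 1..k. frag_cmul (a r) (push (\<lambda>x. star r x y) c))"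
  by (induction c rule: frag_induction[OF subset_UNIV])
     (simp_all add: word_act_def frag_cmul_diff sum_subtractf)

lemma multi_word_boundary_Nil [simp]: "multi_word_boundary [] = 0"
  by (simp add: multi_word_boundary_def)

lemma multi_word_boundary_snoc:
  "multi_word_boundary (xs @ [y]) =
     snoc y (multi_word_boundary xs) + frag_cmul ((- 1) ^ length xs) (word_act y xs)"
proof -
  have "multi_word_boundary (xs @ [y]) = (\<Sum>r = 1..k. frag_cmul (a r) (snoc y (word_boundary (star r) xs))
      + frag_cmul ((- 1) ^ length xs) (frag_cmul (a r) (frag_of (map (\<lambda>x. star r x y) xs))))"
    unfolding multi_word_boundary_def word_boundary_snoc frag_cmul_distrib2 frag_cmul_cmul
    by (intro sum.cong) (simp_all only: mult.commute)
  then show ?thesis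
    unfolding sum.distrib multi_word_boundary_def word_act_def frag_cmul_sum by (simp only: snoc_sum snoc_simps finite_atLeastAtMost)
qed

lemma boundary_snoc:
  assumes "Poly_Mapping.keys c \<subseteq> {xs. length xs = m}"
  shows "boundary (snoc y c) = snoc y (boundary c) + frag_cmul ((- 1) ^ m) (act y c)"
  using assms
  by (induction c rule: frag_induction)
     (simp_all add: multi_word_boundary_snoc frag_cmul_diff)

text \<open>By distributivity, right multiplication by \<open>y\<close> with any of the operations is an endomorphism
  for each of them, hence maps faces to faces.\<close>

lemma boundary_word_act:
  assumes "set xs \<subseteq> X" "y \<in> X"
  shows "boundary (word_act y xs) = act y (multi_word_boundary xs)"
proof -
  have nat: "word_boundary (star r) (map (\<lambda>x. star s x y) xs)
      = push (\<lambda>x. star s x y) (word_boundary (star r) xs)" if "r \<in> {1..k}" "s \<in> {1..k}" for r s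
    using that assms by (intro word_boundary_map star_distrib) auto
  have "boundary (word_act y xs) = (\<Sum>s = 1..k. \<Sum>r = 1..k.
      frag_cmul (a s) (frag_cmul (a r) (push (\<lambda>x. star s x y) (word_boundary (star r) xs))))"
    by (simp add: boundary_def word_act_def frag_extend_sum o_def frag_extend_cmul
        multi_word_boundary_def frag_cmul_sum nat)
  also have "\<dots> = (\<Sum>s = 1..k. frag_cmul (a s) (push (\<lambda>x. star s x y) (multi_word_boundary xs)))"
    by (simp add: multi_word_boundary_def push_sum frag_cmul_sum)
  also have "\<dots> = act y (multi_word_boundary xs)"
    by (simp add: act_altdef)
  finally show ?thesis .
qed

lemma keys_multi_word_boundary:
  assumes "set xs \<subseteq> X"
  shows "Poly_Mapping.keys (multi_word_boundary xs) \<subseteq> {ys. set ys \<subseteq> X \<and> length ys = length xs - 1}"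
proof -
  have "set (face (star r) i xs) \<subseteq> X" if "r \<in> {1..k}" "i < length xs" for r i
  proof -
    have "xs ! i \<in> X" "set (take i xs) \<subseteq> X" "set (drop (Suc i) xs) \<subseteq> X"
      using assms nth_mem[OF that(2)] set_take_subset[of i xs] set_drop_subset[of "Suc i" xs] by blast+
    then show ?thesis
      using star_closed[OF that(1)] by (auto simp: face_def)
  qed
  then have *: "Poly_Mapping.keys (frag_cmul m (frag_of (face (star r) i xs)))
      \<subseteq> {ys. set ys \<subseteq> X \<and> length ys = length xs - 1}" if "r \<in> {1..k}" "i < length xs" for r i m
    using that by (intro order_trans[OF keys_cmul]) (simp add: face_length)
  have "Poly_Mapping.keys (word_boundary (star r) xs)
      \<subseteq> {ys. set ys \<subseteq> X \<and> length ys = length xs - 1}" if "r \<in> {1..k}" for r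
    unfolding word_boundary_def using * that by (intro keys_sum_subset) (simp only: lessThan_iff)
  then show ?thesis
    unfolding multi_word_boundary_def
    by (intro keys_sum_subset order_trans[OF keys_cmul])
qed

text \<open>In \<open>\<partial>\<partial>(S\<^sub>y w) = \<partial>(S\<^sub>y (\<partial>w) \<plusminus> w \<cdot> y)\<close> the first summand contributes
  \<open>\<mp> (\<partial>w) \<cdot> y\<close>, the words of \<open>\<partial>w\<close> being one letter shorter than \<open>w\<close>; this cancels
  \<open>\<plusminus> \<partial>(w \<cdot> y)\<close>.\<close>

lemma boundary_boundary_word: "set xs \<subseteq> X \<Longrightarrow> boundary (multi_word_boundary xs) = 0"
proof (induction xs rule: rev_induct)
  case (snoc y xs)
  then have X: "set xs \<subseteq> X" "y \<in> X" by auto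
  show ?case
  proof (cases xs rule: rev_cases)
    case Nil
    then show ?thesis
      using X boundary_word_act[of "[]" y] multi_word_boundary_snoc[of "[]" y] by simp
  next
    case (snoc v x)
    have "Poly_Mapping.keys (multi_word_boundary xs) \<subseteq> {ys. length ys = length v}"
      using order_trans[OF keys_multi_word_boundary[OF X(1)], of "{ys. length ys = length v}"] snoc
      by (simp add: subset_iff)
    note boundary_snoc[OF this, of y]
    moreover have "boundary (multi_word_boundary xs) = 0"
      using snoc.IH X by blast
    moreover have "(- 1) ^ length xs = - ((- 1) ^ length v :: int)"
      using snoc by simp
    ultimately show ?thesis
      unfolding multi_word_boundary_snoc
      by (simp add: boundary_word_act[OF X] del: minus_frag_cmul flip: minus_frag_cmul)
  qed
qed simp

lemma alpha_act: "alpha (act y c) = act y (alpha c)"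
proof -
  have "alpha (act y c) = (\<Sum>r = 1..k. alpha (frag_cmul (a r) (push (\<lambda>x. star r x y) c)))"
    by (simp add: act_altdef alpha_def frag_extend_sum o_def)
  then show ?thesis
    by (simp add: alpha_push act_altdef)
qed

lemma word_act_idem:
  assumes "x \<in> X"
  shows "word_act x (w @ [x]) = snoc x (word_act x w)"
  using assms by (simp add: word_act_def snoc_sum star_idem)

text \<open>Let \<open>A = \<alpha>(w x)\<close>, let \<open>c = w \<cdot> x\<close>, and let \<open>s\<close> be the sign of the length of \<open>w x\<close>. Expanding
  \<open>\<partial>(S\<^sub>y A - S\<^sub>x A)\<close> and using the induction hypothesis for \<open>\<partial>A\<close>, the terms
  that have to be identified are \<open>S\<^sub>y (\<alpha> c) - S\<^sub>x (\<alpha> c) + A \<cdot> x\<close> and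
  \<open>\<alpha>(S\<^sub>y c)\<close>. Idempotence gives \<open>A \<cdot> x = \<alpha>(S\<^sub>x c)\<close>, and the rest is
  \<open>alpha_last_independent\<close>.\<close>

lemma boundary_alpha_word:
  "set xs \<subseteq> X \<Longrightarrow> boundary (alpha_word xs) = alpha (multi_word_boundary xs)"
proof (induction xs rule: rev_induct)
  case (snoc y xs)
  then have X: "set xs \<subseteq> X" "y \<in> X" by auto
  show ?case
  proof (cases xs rule: rev_cases)
    case Nil
    then show ?thesis
      using alpha_act[of y "frag_of []"] 
      by (simp add: alpha_word_def alpha_tuple_def multi_word_boundary_snoc[of "[]", simplified])
  next
    case (snoc w x)
    have x: "x \<in> X" and w: "set w \<subseteq> X" using X snoc by simp_all
    define A where "A = alpha_word xs"
    define c where "c = word_act x w"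
    define s where "s = ((- 1) ^ length xs :: int)"
    define n where "n = alpha (snoc x (multi_word_boundary w))"
    have keys: "Poly_Mapping.keys A \<subseteq> {ys. length ys = length xs}"
      using order_trans[OF keys_alpha_word, of xs "{ys. length ys = length xs}"]
      by (simp add: A_def subset_iff)
    have last: "xs \<noteq> []" "last xs = x"
      using snoc by simp_all
    have bd: "multi_word_boundary xs = snoc x (multi_word_boundary w) - frag_cmul s c"
      using multi_word_boundary_snoc[of w x] snoc by (simp add: s_def c_def)
    have bdA: "boundary A = n - frag_cmul s (alpha c)"
      using snoc.IH X bd by (simp add: A_def n_def)
    have xA: "act x A = alpha (snoc x c)"
      using word_act_idem[OF x] alpha_act[of x "frag_of xs"] by (simp add: A_def c_def snoc)
    have yA: "act y A = alpha (word_act y xs)"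
      using alpha_act[of y "frag_of xs"] by (simp add: A_def)
    have yc: "alpha (snoc y c) = alpha (snoc x c) - snoc x (alpha c) + snoc y (alpha c)"
      using alpha_last_independent[of y c x] by (simp add: algebra_simps)
    have yn: "alpha (snoc y (snoc x (multi_word_boundary w))) = snoc y n - snoc x n"
      by (simp add: alpha_snoc_snoc n_def)
    have "alpha_word (xs @ [y]) = snoc y A - snoc x A"
      using alpha_word_snoc[of xs y] last by (simp add: A_def)
    then have "boundary (alpha_word (xs @ [y]))
        = snoc y (boundary A) + frag_cmul s (act y A) - (snoc x (boundary A) + frag_cmul s (act x A))"
      using boundary_snoc[OF keys] by (simp add: s_def)
    also have "\<dots> = snoc y n - snoc x n - frag_cmul s (alpha (snoc y c)) + frag_cmul s (act y A)"
      unfolding bdA xA yc frag_cmul_diff frag_cmul_distrib2 snoc_simps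
      by (simp only: algebra_simps)
    also have "\<dots> = alpha (snoc y (multi_word_boundary xs)) + frag_cmul s (act y A)"
      unfolding bd snoc_simps alpha_simps yn ..
    also have "\<dots> = alpha (multi_word_boundary (xs @ [y]))"
      unfolding multi_word_boundary_snoc yA by (simp add: s_def)
    finally show ?thesis .
  qed
qed simp

end

section \<open>The three complexes\<close>

definition degenerate_tuples :: "'a set \<Rightarrow> int \<Rightarrow> 'a list set" where
  "degenerate_tuples X n = {xs \<in> tuples X n. \<not> distinct_adj xs}"

lemma degeneracy_not_distinct_adj:
  assumes "j < length xs"
  shows "\<not> distinct_adj (degeneracy j xs)"
proof -
  have "degeneracy j xs ! j = degeneracy j xs ! Suc j" "Suc j < length (degeneracy j xs)"
    using assms by (simp_all add: degeneracy_def nth_append)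
  then show ?thesis
    using distinct_adj_nth by blast
qed

lemma not_distinct_adj_imp_degeneracy:
  assumes "\<not> distinct_adj xs"
  obtains j ys where "Suc j < length xs" "xs = degeneracy j ys"
    "set ys \<subseteq> set xs" "length xs = Suc (length ys)"
proof -
  obtain j where j: "Suc j < length xs" "xs ! j = xs ! Suc j"
    using assms by (auto simp: distinct_adj_conv_nth)
  let ?ys = "take j xs @ drop (Suc j) xs"
  have "take (Suc j) ?ys = take (Suc j) xs"
    using j by (simp add: take_Suc_conv_app_nth)
  then have "xs = degeneracy j ?ys"
    using j by (simp add: degeneracy_def)
  moreover have "set ?ys \<subseteq> set xs"
    using set_take_subset[of j xs] set_drop_subset[of "Suc j" xs] by simp
  moreover have "length xs = Suc (length ?ys)"
    using j by simp
  ultimately show thesis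
    using that j by blast
qed

lemma subgroup_free_Abelian_group:
  assumes "S \<subseteq> T"
  shows "subgroup (carrier (free_Abelian_group S)) (free_Abelian_group T)"
proof -
  have "Poly_Mapping.keys (b + c) \<subseteq> S"
    if "Poly_Mapping.keys b \<subseteq> S" "Poly_Mapping.keys c \<subseteq> S" for b c :: "'a \<Rightarrow>\<^sub>0 int"
    using that keys_add[of b c] by blast
  moreover have "carrier (free_Abelian_group S) \<noteq> {}"
    using group.is_monoid[OF group_free_Abelian_group] monoid.one_closed by (metis empty_iff)
  ultimately show ?thesis
    using assms by (intro group.subgroupI[OF group_free_Abelian_group]) auto
qed

lemma keys_degeneracy_chain:
  assumes "j < nat n" "Poly_Mapping.keys c \<subseteq> tuples X (n - 1)"
  shows "Poly_Mapping.keys (frag_extend (\<lambda>xs. frag_of (degeneracy j xs)) c) \<subseteq> degenerate_tuples X n"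
proof (rule keys_extend_subset[OF assms(2)])
  fix xs assume xs: "xs \<in> tuples X (n - 1)"
  then have j: "j < length xs"
    using assms(1) by (auto simp: tuples_def)
  have "set (degeneracy j xs) \<subseteq> X"
    using xs set_take_subset[of "Suc j" xs] set_drop_subset[of j xs]
    by (auto simp: degeneracy_def tuples_def)
  moreover have "length (degeneracy j xs) = Suc (length xs)"
    using j by (simp add: degeneracy_def)
  ultimately have "degeneracy j xs \<in> tuples X n"
    using xs by (auto simp: tuples_def)
  then show "Poly_Mapping.keys (frag_of (degeneracy j xs)) \<subseteq> degenerate_tuples X n"
    using degeneracy_not_distinct_adj[OF j] by (simp add: degenerate_tuples_def)
qed

lemma degenerate_tuple_in_degenerate_group:
  assumes "xs \<in> degenerate_tuples X n"
  shows "frag_of xs \<in> carrier (degenerate_group X n)"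
proof -
  obtain j ys where j: "Suc j < length xs" "xs = degeneracy j ys"
    and ys: "set ys \<subseteq> set xs" "length xs = Suc (length ys)"
    using assms by (auto simp: degenerate_tuples_def elim: not_distinct_adj_imp_degeneracy)
  have xs: "set xs \<subseteq> X" "int (length xs) = n + 1"
    using assms by (simp_all add: degenerate_tuples_def tuples_def)
  have "ys \<in> tuples X (n - 1)" "j < nat n"
    using xs ys j(1) by (auto simp: tuples_def)
  then have "frag_of xs \<in> (\<Union>j<nat n. frag_extend (\<lambda>xs. frag_of (degeneracy j xs)) `
          carrier (free_Abelian_group (tuples X (n - 1))))"
    using j(2) by (intro UN_I[of j] image_eqI[of _ _ "frag_of ys"]) auto
  moreover have "frag_of xs \<in> carrier (free_Abelian_group (tuples X n))"
    using assms by (simp add: degenerate_tuples_def)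
  ultimately show ?thesis
    unfolding degenerate_group_def by (simp add: carrier_subgroup_generated generate.incl)
qed

text \<open>A tuple lies in the image of a degeneracy exactly when two adjacent entries agree, so the
  degenerate chains are spanned by a subset of the standard basis.\<close>

lemma carrier_degenerate_group:
  "carrier (degenerate_group X n) = carrier (free_Abelian_group (degenerate_tuples X n))"
proof
  have sub: "degenerate_tuples X n \<subseteq> tuples X n"
    by (auto simp: degenerate_tuples_def)
  have "(\<Union>j<nat n. frag_extend (\<lambda>xs. frag_of (degeneracy j xs)) `
          carrier (free_Abelian_group (tuples X (n - 1))))
      \<subseteq> carrier (free_Abelian_group (degenerate_tuples X n))"
  proof (rule UN_least, rule image_subsetI)
    fix j and c :: "'a list \<Rightarrow>\<^sub>0 int"
    assume "j \<in> {..<nat n}" "c \<in> carrier (free_Abelian_group (tuples X (n - 1)))"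
    then show "frag_extend (\<lambda>xs. frag_of (degeneracy j xs)) c
        \<in> carrier (free_Abelian_group (degenerate_tuples X n))"
      using keys_degeneracy_chain[of j n c X] by simp
  qed
  then show "carrier (degenerate_group X n) \<subseteq> carrier (free_Abelian_group (degenerate_tuples X n))"
    unfolding degenerate_group_def carrier_subgroup_generated
    by (rule group.generate_subgroup_incl[OF group_free_Abelian_group le_infI2
          subgroup_free_Abelian_group[OF sub]])
  have "subgroup (carrier (degenerate_group X n)) (free_Abelian_group (tuples X n))"
    unfolding degenerate_group_def by (rule group.subgroup_subgroup_generated) simp
  note closed = subgroup.one_closed[OF this] subgroup.m_closed[OF this] subgroup.m_inv_closed[OF this]
    subgroup.mem_carrier[OF this]
  have "c \<in> carrier (degenerate_group X n)" if "Poly_Mapping.keys c \<subseteq> degenerate_tuples X n" for c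
    using that
  proof (induction c rule: frag_induction)
    case (diff b c)
    then show ?case
      using closed(2)[of b "- c"] closed(3)[of c] closed(4)[of c] by simp
  qed (use closed degenerate_tuple_in_degenerate_group in auto)
  then show "carrier (free_Abelian_group (degenerate_tuples X n)) \<subseteq> carrier (degenerate_group X n)"
    by auto
qed

lemma degenerate_group_eq:
  "degenerate_group X n =
     (free_Abelian_group (tuples X n))\<lparr>carrier := carrier (free_Abelian_group (degenerate_tuples X n))\<rparr>"
  using carrier_degenerate_group[of X n] unfolding degenerate_group_def subgroup_generated_def by simp

lemma subgroup_degenerate_group:
  "subgroup (carrier (degenerate_group X n)) (free_Abelian_group (tuples X n))"
  unfolding carrier_degenerate_group
  by (rule subgroup_free_Abelian_group) (auto simp: degenerate_tuples_def)

lemma comm_group_degenerate_group: "comm_group (degenerate_group X n)"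
  unfolding degenerate_group_def
  by (rule group.abelian_subgroup_generated) (simp_all add: abelian_free_Abelian_group)

lemma quotient_map_eq:
  "quotient_map X n c = (\<lambda>d. d + c) ` carrier (free_Abelian_group (degenerate_tuples X n))"
  by (auto simp: quotient_map_def r_coset_def carrier_degenerate_group)

lemma quotient_map_eq_iff:
  assumes "Poly_Mapping.keys b \<subseteq> tuples X n" "Poly_Mapping.keys c \<subseteq> tuples X n"
  shows "quotient_map X n b = quotient_map X n c
     \<longleftrightarrow> Poly_Mapping.keys (b - c) \<subseteq> degenerate_tuples X n"
proof
  assume "quotient_map X n b = quotient_map X n c"
  moreover have "b \<in> quotient_map X n b"
    unfolding quotient_map_eq by (rule image_eqI[of _ _ 0]) simp_all
  ultimately show "Poly_Mapping.keys (b - c) \<subseteq> degenerate_tuples X n"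
    by (auto simp: quotient_map_eq)
next
  assume "Poly_Mapping.keys (b - c) \<subseteq> degenerate_tuples X n"
  then have "b \<in> quotient_map X n c"
    unfolding quotient_map_eq by (intro image_eqI[of _ _ "b - c"]) simp_all
  then show "quotient_map X n b = quotient_map X n c"
    using group.repr_independence[OF group_free_Abelian_group _ _ subgroup_degenerate_group, of b X n c] assms
    by (simp add: quotient_map_def)
qed

lemma quotient_map_hom:
  "quotient_map X n \<in> hom (free_Abelian_group (tuples X n))
     (free_Abelian_group (tuples X n) Mod carrier (degenerate_group X n))"
  using normal.r_coset_hom_Mod[OF comm_group.subgroup_imp_normal[OF abelian_free_Abelian_group
      subgroup_degenerate_group]]
  by (simp add: quotient_map_def[abs_def])

lemma the_elem_quotient_map:
  assumes "\<And>d. Poly_Mapping.keys d \<subseteq> degenerate_tuples X n \<Longrightarrow> h (d + c) = h c"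
  shows "the_elem (h ` quotient_map X n c) = h c"
proof -
  have "h ` quotient_map X n c = {h c}"
    using assms unfolding quotient_map_eq by (auto simp: image_image intro!: image_eqI[of _ _ 0])
  then show ?thesis by simp
qed

context multispindle_chains
begin

lemma multi_boundary_eq:
  assumes "Poly_Mapping.keys c \<subseteq> tuples X n"
  shows "multi_boundary k star a n c = (if n \<le> 0 then 0 else boundary c)"
proof -
  have "star_boundary f n c = (if n \<le> 0 then 0 else frag_extend (word_boundary f) c)" for f
  proof -
    have "{..nat n} = {..<length xs}" if "xs \<in> Poly_Mapping.keys c" "n > 0" for xs
    proof -
      have "length xs = Suc (nat n)"
        using that assms by (auto simp: tuples_def)
      then show ?thesis by (simp add: lessThan_Suc_atMost)
    qed
    then show ?thesis
      unfolding star_boundary_def word_boundary_def by (auto intro!: frag_extend_eq)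
  qed
  then show ?thesis
    by (simp add: multi_boundary_def boundary_altdef)
qed

lemma multi_boundary_add:
  "multi_boundary k star a n (b + c) = multi_boundary k star a n b + multi_boundary k star a n c"
  by (cases "n \<le> 0")
     (simp_all add: multi_boundary_def star_boundary_def frag_extend_add frag_cmul_distrib2 sum.distrib)

lemma keys_multi_boundary:
  assumes "Poly_Mapping.keys c \<subseteq> tuples X n"
  shows "Poly_Mapping.keys (multi_boundary k star a n c) \<subseteq> tuples X (n - 1)"
proof (cases "n \<le> 0")
  case False
  have "Poly_Mapping.keys (boundary c) \<subseteq> tuples X (n - 1)"
    unfolding boundary_def
  proof (rule keys_extend_subset[OF assms])
    fix xs assume "xs \<in> tuples X n"
    then have "set xs \<subseteq> X" and len: "int (length xs) = n + 1"
      by (simp_all add: tuples_def)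
    have "ys \<in> tuples X (n - 1)" if "set ys \<subseteq> X \<and> length ys = length xs - 1" for ys
      using that len False by (auto simp: tuples_def)
    then show "Poly_Mapping.keys (multi_word_boundary xs) \<subseteq> tuples X (n - 1)"
      using keys_multi_word_boundary[OF \<open>set xs \<subseteq> X\<close>] by blast
  qed
  then show ?thesis
    using False by (simp add: multi_boundary_eq[OF assms])
qed (simp add: multi_boundary_eq[OF assms])

lemma multi_boundary_multi_boundary:
  assumes "Poly_Mapping.keys c \<subseteq> tuples X n"
  shows "multi_boundary k star a (n - 1) (multi_boundary k star a n c) = 0"
proof -
  have "boundary (boundary c) = 0"
    using assms
  proof (induction c rule: frag_induction)
    case (one xs)
    then show ?case
      using boundary_boundary_word by (simp add: tuples_def)
  qed simp_all
  then show ?thesis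
    using multi_boundary_eq[OF keys_multi_boundary[OF assms]] multi_boundary_eq[OF assms] by simp
qed

lemma keys_alpha:
  assumes "Poly_Mapping.keys c \<subseteq> tuples X n"
  shows "Poly_Mapping.keys (alpha c) \<subseteq> tuples X n"
  unfolding alpha_def
proof (rule keys_extend_subset[OF assms])
  fix xs assume xs: "xs \<in> tuples X n"
  have "{ys. length ys = length xs \<and> set ys \<subseteq> set xs} \<subseteq> tuples X n"
    using xs by (auto simp: tuples_def)
  then show "Poly_Mapping.keys (alpha_word xs) \<subseteq> tuples X n"
    using keys_alpha_word by (rule order_trans[rotated])
qed

lemma keys_alpha_minus:
  assumes "Poly_Mapping.keys c \<subseteq> tuples X n"
  shows "Poly_Mapping.keys (alpha c - c) \<subseteq> degenerate_tuples X n"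
  using assms
proof (induction c rule: frag_induction)
  case (one xs)
  have "{ys. length ys = length xs \<and> set ys \<subseteq> set xs \<and> \<not> distinct_adj ys} \<subseteq> degenerate_tuples X n"
    using one by (auto simp: tuples_def degenerate_tuples_def)
  then show ?case
    using keys_alpha_word_minus[of xs] by simp
next
  case (diff b c)
  have "alpha (b - c) - (b - c) = (alpha b - b) - (alpha c - c)"
    unfolding alpha_simps by (rule diff_diff_swap)
  then show ?case
    using diff keys_diff[of "alpha b - b" "alpha c - c"] by (metis Un_least order_trans)
qed simp

lemma alpha_degenerate:
  assumes "Poly_Mapping.keys c \<subseteq> degenerate_tuples X n"
  shows "alpha c = 0"
  unfolding alpha_def using assms alpha_word_degenerate
  by (intro frag_extend_eq_0) (auto simp: degenerate_tuples_def)

lemma alpha_multi_boundary: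
  assumes "Poly_Mapping.keys c \<subseteq> tuples X n"
  shows "multi_boundary k star a n (alpha c) = alpha (multi_boundary k star a n c)"
proof -
  have "boundary (alpha c) = alpha (boundary c)"
    using assms
  proof (induction c rule: frag_induction)
    case (one xs)
    then show ?case
      using boundary_alpha_word by (simp add: tuples_def)
  qed simp_all
  then show ?thesis
    using multi_boundary_eq[OF keys_alpha[OF assms]] multi_boundary_eq[OF assms] by simp
qed

text \<open>If \<open>c\<close> is degenerate then \<open>\<alpha>(\<partial>c) = \<partial>(\<alpha> c) = 0\<close>, and a chain killed by
  \<open>\<alpha>\<close> is degenerate because \<open>\<alpha>\<close> is the identity up to degenerate chains.\<close>

lemma keys_multi_boundary_degenerate:
  assumes "Poly_Mapping.keys c \<subseteq> degenerate_tuples X n"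
  shows "Poly_Mapping.keys (multi_boundary k star a n c) \<subseteq> degenerate_tuples X (n - 1)"
proof -
  have c: "Poly_Mapping.keys c \<subseteq> tuples X n"
    using assms by (auto simp: degenerate_tuples_def)
  have "alpha (multi_boundary k star a n c) = multi_boundary k star a n 0"
    using alpha_multi_boundary[OF c] alpha_degenerate[OF assms] by simp
  then have "alpha (multi_boundary k star a n c) = 0"
    by (simp add: multi_boundary_eq)
  then show ?thesis
    using keys_alpha_minus[OF keys_multi_boundary[OF c]] by simp
qed

lemma chain_complex_multi: "chain_complex (multi_complex X k star a)"
  unfolding chain_complex_def multi_complex_def
  using multi_boundary_multi_boundary keys_multi_boundary
  by (auto simp: abelian_free_Abelian_group multi_boundary_add intro!: homI)

lemma chain_complex_degenerate: "chain_complex (degenerate_complex X k star a)"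
  unfolding chain_complex_def degenerate_complex_def
proof (intro conjI allI ballI; simp)
  fix n
  show "comm_group (degenerate_group X n)"
    by (rule comm_group_degenerate_group)
  show "multi_boundary k star a n \<in> hom (degenerate_group X n) (degenerate_group X (n - 1))"
    by (rule homI) (simp_all add: degenerate_group_eq keys_multi_boundary_degenerate multi_boundary_add)
  fix c assume "c \<in> carrier (degenerate_group X n)"
  then have "Poly_Mapping.keys c \<subseteq> tuples X n"
    by (auto simp: carrier_degenerate_group degenerate_tuples_def)
  then show "multi_boundary k star a (n - 1) (multi_boundary k star a n c) = \<one>\<^bsub>degenerate_group X (n - 2)\<^esub>"
    by (simp add: multi_boundary_multi_boundary degenerate_group_eq)
qed

lemma carrier_normalized:
  "carrier (grp (normalized_complex X k star a) n) =
     quotient_map X n ` carrier (free_Abelian_group (tuples X n))"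
  by (simp add: normalized_complex_def carrier_FactGroup quotient_map_def)

lemma bdry_normalized:
  assumes "Poly_Mapping.keys c \<subseteq> tuples X n"
  shows "bdry (normalized_complex X k star a) n (quotient_map X n c) =
    quotient_map X (n - 1) (multi_boundary k star a n c)"
proof -
  have "quotient_map X (n - 1) (multi_boundary k star a n (d + c))
      = quotient_map X (n - 1) (multi_boundary k star a n c)"
    if d: "Poly_Mapping.keys d \<subseteq> degenerate_tuples X n" for d
  proof -
    have "Poly_Mapping.keys d \<subseteq> tuples X n"
      using d by (auto simp: degenerate_tuples_def)
    then have dc: "Poly_Mapping.keys (d + c) \<subseteq> tuples X n"
      using assms keys_add[of d c] by blast
    show ?thesis
      using quotient_map_eq_iff[OF keys_multi_boundary[OF dc] keys_multi_boundary[OF assms]]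
        keys_multi_boundary_degenerate[OF d]
      by (simp add: multi_boundary_add)
  qed
  then show ?thesis
    unfolding normalized_complex_def by (simp add: the_elem_quotient_map)
qed

lemma quotient_map_add:
  assumes "Poly_Mapping.keys b \<subseteq> tuples X n" "Poly_Mapping.keys c \<subseteq> tuples X n"
  shows "quotient_map X n b \<otimes>\<^bsub>grp (normalized_complex X k star a) n\<^esub> quotient_map X n c
    = quotient_map X n (b + c)"
  using hom_mult[OF quotient_map_hom[of X n], of b c] assms by (simp add: normalized_complex_def)

lemma one_normalized: "\<one>\<^bsub>grp (normalized_complex X k star a) n\<^esub> = quotient_map X n 0"
  by (simp add: normalized_complex_def quotient_map_eq carrier_degenerate_group)

lemma chain_complex_normalized: "chain_complex (normalized_complex X k star a)"
  unfolding chain_complex_def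
proof (intro conjI allI ballI)
  fix n
  let ?N = "normalized_complex X k star a"
  show "comm_group (grp ?N n)"
    unfolding normalized_complex_def chain_data.simps
    by (rule comm_group.abelian_FactGroup[OF abelian_free_Abelian_group subgroup_degenerate_group])
  show "bdry ?N n \<in> hom (grp ?N n) (grp ?N (n - 1))"
  proof (rule homI)
    fix y z assume "y \<in> carrier (grp ?N n)" "z \<in> carrier (grp ?N n)"
    then obtain b c where bc: "y = quotient_map X n b" "z = quotient_map X n c"
      "Poly_Mapping.keys b \<subseteq> tuples X n" "Poly_Mapping.keys c \<subseteq> tuples X n"
      by (auto simp: carrier_normalized)
    moreover have "Poly_Mapping.keys (b + c) \<subseteq> tuples X n"
      using bc keys_add[of b c] by blast
    ultimately show "bdry ?N n (y \<otimes>\<^bsub>grp ?N n\<^esub> z) = bdry ?N n y \<otimes>\<^bsub>grp ?N (n - 1)\<^esub> bdry ?N n z"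
      by (simp add: quotient_map_add bdry_normalized keys_multi_boundary multi_boundary_add)
  qed (auto simp: carrier_normalized bdry_normalized keys_multi_boundary)
  fix z assume "z \<in> carrier (grp ?N n)"
  then show "bdry ?N (n - 1) (bdry ?N n z) = \<one>\<^bsub>grp ?N (n - 2)\<^esub>"
    by (auto simp: carrier_normalized bdry_normalized keys_multi_boundary
        multi_boundary_multi_boundary one_normalized)
qed

lemma short_exact:
  "short_exact_complexes (degenerate_complex X k star a) (\<lambda>n c. c)
     (multi_complex X k star a) (quotient_map X) (normalized_complex X k star a)"
  unfolding short_exact_complexes_def
proof (intro conjI allI)
  let ?D = "degenerate_complex X k star a" and ?C = "multi_complex X k star a"
    and ?N = "normalized_complex X k star a"
  show "chain_complex ?D" "chain_complex ?C" "chain_complex ?N"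
    by (rule chain_complex_degenerate chain_complex_multi chain_complex_normalized)+
  have incl: "(\<lambda>c. c) \<in> hom (grp ?D n) (grp ?C n)" for n
    by (rule homI)
       (auto simp: degenerate_complex_def multi_complex_def degenerate_group_eq degenerate_tuples_def)
  have quot: "quotient_map X n \<in> hom (grp ?C n) (grp ?N n)" for n
    using quotient_map_hom by (simp add: multi_complex_def normalized_complex_def)
  show "chain_map ?D ?C (\<lambda>n c. c)"
    using incl by (simp add: chain_map_def degenerate_complex_def multi_complex_def)
  show "chain_map ?C ?N (quotient_map X)"
    using quot by (simp add: chain_map_def bdry_normalized) (simp add: multi_complex_def bdry_normalized)
  fix n
  show "(\<lambda>c. c) \<in> mon (grp ?D n) (grp ?C n)"
    using incl by (simp add: mon_def)
  show "quotient_map X n \<in> epi (grp ?C n) (grp ?N n)"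
    using quot by (simp add: epi_def carrier_normalized) (simp add: multi_complex_def)
  show "(\<lambda>c. c) ` carrier (grp ?D n) = kernel (grp ?C n) (grp ?N n) (quotient_map X n)"
  proof -
    have "quotient_map X n c = quotient_map X n 0 \<longleftrightarrow> Poly_Mapping.keys c \<subseteq> degenerate_tuples X n"
      if "Poly_Mapping.keys c \<subseteq> tuples X n" for c
      using quotient_map_eq_iff[OF that, of 0] by simp
    then have "kernel (grp ?C n) (grp ?N n) (quotient_map X n)
        = {c. Poly_Mapping.keys c \<subseteq> tuples X n \<and> Poly_Mapping.keys c \<subseteq> degenerate_tuples X n}"
      unfolding kernel_def one_normalized by (simp add: multi_complex_def cong: conj_cong)
    also have "\<dots> = carrier (free_Abelian_group (degenerate_tuples X n))"
      unfolding degenerate_tuples_def by auto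
    finally show ?thesis
      by (simp add: degenerate_complex_def carrier_degenerate_group)
  qed
qed

definition splitting :: "int \<Rightarrow> ('a list \<Rightarrow>\<^sub>0 int) set \<Rightarrow> ('a list \<Rightarrow>\<^sub>0 int)" where
  "splitting n z = the_elem (alpha ` z)"

lemma splitting_quotient_map: "splitting n (quotient_map X n c) = alpha c"
  unfolding splitting_def using alpha_degenerate by (intro the_elem_quotient_map) simp

lemma splitting_frag_of:
  "xs \<in> tuples X n \<Longrightarrow> splitting n (quotient_map X n (frag_of xs)) = alpha_tuple xs"
  by (simp add: splitting_quotient_map alpha_word_def tuples_def)

lemma splitting_chain_map:
  "splitting_chain_map (multi_complex X k star a) (quotient_map X) (normalized_complex X k star a) splitting"
  unfolding splitting_chain_map_def chain_map_def
proof (intro conjI allI ballI)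
  let ?C = "multi_complex X k star a" and ?N = "normalized_complex X k star a"
  fix n
  show "splitting n \<in> hom (grp ?N n) (grp ?C n)"
    by (rule homI)
       (auto simp: carrier_normalized quotient_map_add splitting_quotient_map multi_complex_def
          dest: subsetD[OF keys_alpha])
  fix z assume "z \<in> carrier (grp ?N n)"
  then obtain c where z: "z = quotient_map X n c" and c: "Poly_Mapping.keys c \<subseteq> tuples X n"
    by (auto simp: carrier_normalized)
  show "bdry ?C n (splitting n z) = splitting (n - 1) (bdry ?N n z)"
    using alpha_multi_boundary[OF c]
    by (simp add: z bdry_normalized[OF c] splitting_quotient_map) (simp add: multi_complex_def)
  show "quotient_map X n (splitting n z) = z"
    using keys_alpha_minus[OF c] quotient_map_eq_iff[OF keys_alpha[OF c] c]
    by (simp add: z splitting_quotient_map)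
qed

end

theorem theorem4p8:
  fixes X :: "'a set" and k :: nat
    and star :: "nat \<Rightarrow> 'a \<Rightarrow> 'a \<Rightarrow> 'a" and a :: "nat \<Rightarrow> int"
  assumes "multispindle X k star"
  shows "short_exact_complexes
           (degenerate_complex X k star a) (\<lambda>n c. c)
           (multi_complex X k star a) (quotient_map X)
           (normalized_complex X k star a)
       \<and> (\<exists>\<alpha>. splitting_chain_map
                 (multi_complex X k star a) (quotient_map X)
                 (normalized_complex X k star a) \<alpha>
               \<and> (\<forall>n. \<forall>xs \<in> tuples X n.
                     \<alpha> n (quotient_map X n (frag_of xs)) = alpha_tuple xs))
       \<and> (\<forall>n. homology (multi_complex X k star a) n \<cong>
               homology (degenerate_complex X k star a) n \<times>\<times>
               homology (normalized_complex X k star a) n)"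
proof -
  interpret multispindle_chains X k star a
    by standard (rule assms)
  show ?thesis
    using short_exact splitting_chain_map splitting_frag_of
      homology_split_exact[OF short_exact splitting_chain_map] by blast
qed

end
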